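(* Let $\mathcal{C}$ be a configuration of curves in a smooth surface $\Sigma$ with ordinary multiple points, let $\gamma_0\in\mathcal{C}$, and let $\mathcal{C}'=\mathcal{C}\setminus\{\gamma_0\}$. Then $$\psi(\mathcal{C})=\psi(\mathcal{C}')+v_0,$$ where $v_0$ is the number of distinct singular points of $\mathcal{C}$ lying on $\gamma_0$ (counted set-theoretically).
   Context: A configuration is a finite set of distinct reduced irreducible curves in a smooth surface $\Sigma$ (a smooth projective surface such as $\mathbb{P}^2$ in the algebraic case, or $\mathbb{R}^2$ in the semialgebraic case), all of whose mutual intersections are finitely many ordinary multiple points. $\operatorname{Sing}(\mathcal{C})$ is the set of points lying on at least two curves of $\mathcal{C}$, $k_p$ is the number of curves of $\mathcal{C}$ through $p$, and $\psi(\mathcal{C})=\sum_{p\in\operatorname{Sing}(\mathcal{C})}(k_p-1)$; $\psi(\mathcal{C}')$ is defined in the same way with singular points and multiplicities computed in $\mathcal{C}'$. *)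

theory Defs
  imports "HOL-Analysis.Analysis" "HOL-Library.Poly_Mapping"
    "HOL-Computational_Algebra.Polynomial"
begin

section \<open>Polynomials in finitely many variables\<close>

text \<open>Variables are indexed by the finite type \<open>'n\<close>; a polynomial maps finitely many
  exponent vectors to nonzero coefficients.\<close>

type_synonym ('k, 'n) mpol = "('n \<Rightarrow>\<^sub>0 nat) \<Rightarrow>\<^sub>0 'k"

definition mp_eval :: "('k::field, 'n::finite) mpol \<Rightarrow> 'k ^ 'n \<Rightarrow> 'k" where
  "mp_eval f x = (\<Sum>m\<in>Poly_Mapping.keys f. Poly_Mapping.lookup f m *
      (\<Prod>i\<in>UNIV. (x $ i) ^ Poly_Mapping.lookup m i))"

definition mp_homogeneous :: "('k::field, 'n::finite) mpol \<Rightarrow> bool" where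
  "mp_homogeneous f \<longleftrightarrow>
     (\<exists>d. \<forall>m\<in>Poly_Mapping.keys f. (\<Sum>i\<in>UNIV. Poly_Mapping.lookup m i) = d)"

text \<open>\<open>mp_taylor f v j w\<close> is the coefficient of \<open>t ^ j\<close> in \<open>f (v + t w)\<close>, i.e. the
  homogeneous part of degree \<open>j\<close> of the expansion of \<open>f\<close> at \<open>v\<close>, evaluated at \<open>w\<close>. It is
  computed formally, hence meaningful in every characteristic; \<open>j = 1\<close> gives the
  differential of \<open>f\<close> at \<open>v\<close>.\<close>

definition mp_taylor :: "('k::field, 'n::finite) mpol \<Rightarrow> 'k ^ 'n \<Rightarrow> nat \<Rightarrow> 'k ^ 'n \<Rightarrow> 'k" where
  "mp_taylor f v j w = coeff (\<Sum>m\<in>Poly_Mapping.keys f. smult (Poly_Mapping.lookup f m)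
      (\<Prod>i\<in>UNIV. [:v $ i, w $ i:] ^ Poly_Mapping.lookup m i)) j"

definition mp_vanishes_to_order :: "('k::field, 'n::finite) mpol \<Rightarrow> 'k ^ 'n \<Rightarrow> nat \<Rightarrow> bool" where
  "mp_vanishes_to_order f v r \<longleftrightarrow> (\<forall>j<r. \<forall>w. mp_taylor f v j w = 0)"


section \<open>Irreducibility and dimension with respect to a family of closed sets\<close>

definition irreducible_wrt :: "('p set \<Rightarrow> bool) \<Rightarrow> 'p set \<Rightarrow> bool" where
  "irreducible_wrt cl Z \<longleftrightarrow> Z \<noteq> {} \<and>
     (\<forall>A B. cl A \<and> cl B \<and> Z \<subseteq> A \<union> B \<longrightarrow> Z \<subseteq> A \<or> Z \<subseteq> B)"

definition irreducible_chain_in :: "('p set \<Rightarrow> bool) \<Rightarrow> 'p set \<Rightarrow> nat \<Rightarrow> bool" where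
  "irreducible_chain_in cl Z d \<longleftrightarrow>
     (\<exists>c :: nat \<Rightarrow> 'p set. (\<forall>i\<le>d. cl (c i) \<and> irreducible_wrt cl (c i) \<and> c i \<subseteq> Z) \<and>
                          (\<forall>i<d. c i \<subset> c (Suc i)))"

text \<open>Krull dimension of a closed set.\<close>

definition has_krull_dim :: "('p set \<Rightarrow> bool) \<Rightarrow> 'p set \<Rightarrow> nat \<Rightarrow> bool" where
  "has_krull_dim cl Z d \<longleftrightarrow> irreducible_chain_in cl Z d \<and> \<not> irreducible_chain_in cl Z (Suc d)"


section \<open>Projective varieties over an algebraically closed field\<close>

text \<open>The points of the projective space of dimension \<open>CARD('n) - 1\<close> are the
  one-dimensional subspaces of \<open>'k ^ 'n\<close>.\<close>

definition proj_space :: "('k::field ^ 'n::finite) set set" where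
  "proj_space = {vec.span {v} | v. v \<noteq> 0}"

definition proj_closed :: "('k::field ^ 'n::finite) set set \<Rightarrow> bool" where
  "proj_closed Z \<longleftrightarrow> (\<exists>F. (\<forall>f\<in>F. mp_homogeneous f) \<and>
     Z = {p \<in> proj_space. \<forall>f\<in>F. \<forall>v\<in>p. mp_eval f v = 0})"

text \<open>All polynomials vanishing on the affine cone over \<open>Z\<close>.\<close>

definition cone_ideal :: "('k::field ^ 'n::finite) set set \<Rightarrow> ('k, 'n) mpol set" where
  "cone_ideal Z = {f. \<forall>p\<in>Z. \<forall>v\<in>p. mp_eval f v = 0}"

text \<open>Tangent spaces are taken on the affine cone: this is the Zariski tangent space of the
  cone at any nonzero representative of \<open>p\<close>. It contains the line \<open>p\<close>, and the tangent
  space of \<open>Z\<close> at \<open>p\<close> is its quotient by \<open>p\<close> (up to a twist). Thus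
  \<open>Z\<close> is smooth of dimension \<open>d\<close> at \<open>p\<close> iff this space has dimension \<open>d + 1\<close>.\<close>

definition cone_tangent_space ::
    "('k::field ^ 'n::finite) set set \<Rightarrow> ('k ^ 'n) set \<Rightarrow> ('k ^ 'n) set" where
  "cone_tangent_space Z p = {w. \<forall>v\<in>p - {0}. \<forall>f\<in>cone_ideal Z. mp_taylor f v 1 w = 0}"

definition smooth_projective_surface :: "('k::alg_closed_field ^ 'n::finite) set set \<Rightarrow> bool" where
  "smooth_projective_surface S \<longleftrightarrow>
     proj_closed S \<and> irreducible_wrt proj_closed S \<and> has_krull_dim proj_closed S 2 \<and>
     (\<forall>p\<in>S. vec.dim (cone_tangent_space S p) = 3)"

text \<open>A reduced irreducible curve is identified with its set of closed points.\<close>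

definition algebraic_curve_in ::
    "('k::alg_closed_field ^ 'n::finite) set set \<Rightarrow> ('k ^ 'n) set set \<Rightarrow> bool" where
  "algebraic_curve_in S \<gamma> \<longleftrightarrow>
     \<gamma> \<subseteq> S \<and> proj_closed \<gamma> \<and> irreducible_wrt proj_closed \<gamma> \<and> has_krull_dim proj_closed \<gamma> 1"

text \<open>The multiplicity at \<open>p\<close> of a reduced curve \<open>D\<close> on a smooth surface \<open>S\<close> is the largest \<open>r\<close>
  such that the local equation of \<open>D\<close> lies in the \<open>r\<close>-th power of the maximal ideal of the
  local ring of \<open>S\<close> at \<open>p\<close>, i.e. such that the ideal of \<open>D\<close> is contained in the sum of the
  ideal of \<open>S\<close> and the ideal of polynomials vanishing to order \<open>r\<close>. Passing to
  the affine cone does not change this number.\<close>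

definition curve_multiplicity_ge ::
    "('k::field ^ 'n::finite) set set \<Rightarrow> ('k ^ 'n) set set \<Rightarrow> ('k ^ 'n) set \<Rightarrow> nat \<Rightarrow> bool" where
  "curve_multiplicity_ge S D p r \<longleftrightarrow>
     (\<forall>v\<in>p - {0}. \<forall>f\<in>cone_ideal D. \<exists>g\<in>cone_ideal S. mp_vanishes_to_order (f - g) v r)"

definition has_curve_multiplicity ::
    "('k::field ^ 'n::finite) set set \<Rightarrow> ('k ^ 'n) set set \<Rightarrow> ('k ^ 'n) set \<Rightarrow> nat \<Rightarrow> bool" where
  "has_curve_multiplicity S D p r \<longleftrightarrow>
     curve_multiplicity_ge S D p r \<and> \<not> curve_multiplicity_ge S D p (Suc r)"

text \<open>The tangent cone is cut out by the lowest-order forms at \<open>v\<close> of the polynomials in the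
  ideal. The tangent lines of \<open>D\<close> at \<open>p\<close> are the lines in the tangent plane of the
  surface; on the cone they become two-dimensional subspaces containing \<open>p\<close>.\<close>

definition tangent_cone ::
    "('k::field ^ 'n::finite) set set \<Rightarrow> ('k ^ 'n) set \<Rightarrow> ('k ^ 'n) set" where
  "tangent_cone D p = {w. \<forall>v\<in>p - {0}. \<forall>f\<in>cone_ideal D. \<forall>r.
      mp_vanishes_to_order f v r \<longrightarrow> mp_taylor f v r w = 0}"

definition tangent_lines ::
    "('k::field ^ 'n::finite) set set \<Rightarrow> ('k ^ 'n) set \<Rightarrow> ('k ^ 'n) set set" where
  "tangent_lines D p = {L. vec.subspace L \<and> vec.dim L = 2 \<and> p \<subseteq> L \<and> L \<subseteq> tangent_cone D p}"

text \<open>A point of multiplicity \<open>r \<ge> 2\<close> is ordinary if there are \<open>r\<close> distinct tangent lines.\<close>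

definition ordinary_multiple_point ::
    "('k::field ^ 'n::finite) set set \<Rightarrow> ('k ^ 'n) set set \<Rightarrow> ('k ^ 'n) set \<Rightarrow> bool" where
  "ordinary_multiple_point S D p \<longleftrightarrow>
     (\<exists>r\<ge>2. has_curve_multiplicity S D p r \<and> card (tangent_lines D p) = r)"


section \<open>Semialgebraic curves in the real plane\<close>

definition semialgebraic :: "(real ^ 'n::finite) set \<Rightarrow> bool" where
  "semialgebraic A \<longleftrightarrow>
     (\<exists>B :: ((real, 'n) mpol \<times> (real, 'n) mpol set) set.
        finite B \<and> (\<forall>(f, G)\<in>B. finite G) \<and>
        A = (\<Union>(f, G)\<in>B. {x. mp_eval f x = 0 \<and> (\<forall>g\<in>G. mp_eval g x > 0)}))"

definition zariski_closed :: "('k::field ^ 'n::finite) set \<Rightarrow> bool" where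
  "zariski_closed Z \<longleftrightarrow> (\<exists>F. Z = {x. \<forall>f\<in>F. mp_eval f x = 0})"

definition zariski_closure :: "('k::field ^ 'n::finite) set \<Rightarrow> ('k ^ 'n) set" where
  "zariski_closure A = \<Inter> {Z. zariski_closed Z \<and> A \<subseteq> Z}"

text \<open>The dimension of a semialgebraic set is that of its Zariski closure; irreducibility
  refers to the Zariski topology as well.\<close>

definition semialgebraic_curve :: "(real ^ 2) set \<Rightarrow> bool" where
  "semialgebraic_curve \<gamma> \<longleftrightarrow>
     semialgebraic \<gamma> \<and> irreducible_wrt zariski_closed \<gamma> \<and>
     has_krull_dim zariski_closed (zariski_closure \<gamma>) 1"

primrec Ck_on :: "nat \<Rightarrow> (real ^ 2) set \<Rightarrow> (real ^ 2 \<Rightarrow> real) \<Rightarrow> bool" where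
  "Ck_on 0 U h \<longleftrightarrow> continuous_on U h"
| "Ck_on (Suc k) U h \<longleftrightarrow>
     (\<exists>h' :: 2 \<Rightarrow> real ^ 2 \<Rightarrow> real.
        (\<forall>x\<in>U. (h has_derivative (\<lambda>w. \<Sum>i\<in>UNIV. w $ i * h' i x)) (at x)) \<and>
        (\<forall>i. Ck_on k U (h' i)))"

text \<open>Near \<open>p\<close> the curves through \<open>p\<close> are made up of \<open>r \<ge> 2\<close> smooth branches \<open>h i = 0\<close> with
  pairwise distinct tangent lines; branch \<open>i\<close> belongs to the curve \<open>b i\<close>, and \<open>G i\<close> is the
  gradient of \<open>h i\<close> at \<open>p\<close>.\<close>

definition ordinary_multiple_point_real :: "(real ^ 2) set set \<Rightarrow> real ^ 2 \<Rightarrow> bool" where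
  "ordinary_multiple_point_real C p \<longleftrightarrow>
     (\<exists>U (r::nat) (h :: nat \<Rightarrow> real ^ 2 \<Rightarrow> real) (G :: nat \<Rightarrow> real ^ 2) (b :: nat \<Rightarrow> (real ^ 2) set).
        open U \<and> p \<in> U \<and> r \<ge> 2 \<and>
        (\<forall>i<r. (\<forall>k. Ck_on k U (h i)) \<and> h i p = 0 \<and>
               (h i has_derivative (\<lambda>w. G i \<bullet> w)) (at p) \<and> G i \<noteq> 0 \<and>
               b i \<in> C \<and> p \<in> b i) \<and>
        inj_on (\<lambda>i. {w. G i \<bullet> w = 0}) {..<r} \<and>
        (\<forall>\<gamma>\<in>C. p \<in> \<gamma> \<longrightarrow> \<gamma> \<inter> U = {x \<in> U. \<exists>i<r. b i = \<gamma> \<and> h i x = 0}))"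


section \<open>Configurations\<close>

definition curve_count :: "'p set set \<Rightarrow> 'p \<Rightarrow> nat" where
  "curve_count C p = card {\<gamma> \<in> C. p \<in> \<gamma>}"

definition Sing :: "'p set set \<Rightarrow> 'p set" where
  "Sing C = {p. \<exists>\<gamma>\<in>C. \<exists>\<delta>\<in>C. \<gamma> \<noteq> \<delta> \<and> p \<in> \<gamma> \<and> p \<in> \<delta>}"

definition psi :: "'p set set \<Rightarrow> int" where
  "psi C = (\<Sum>p\<in>Sing C. (int (curve_count C p) - 1))"

definition algebraic_configuration ::
    "('k::alg_closed_field ^ 'n::finite) set set \<Rightarrow> ('k ^ 'n) set set set \<Rightarrow> bool" where
  "algebraic_configuration S C \<longleftrightarrow>
     finite C \<and> (\<forall>\<gamma>\<in>C. algebraic_curve_in S \<gamma>) \<and>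
     (\<forall>\<gamma>\<in>C. \<forall>\<delta>\<in>C. \<gamma> \<noteq> \<delta> \<longrightarrow> finite (\<gamma> \<inter> \<delta>)) \<and>
     (\<forall>p\<in>Sing C. ordinary_multiple_point S (\<Union>C) p)"

definition semialgebraic_configuration :: "(real ^ 2) set set \<Rightarrow> bool" where
  "semialgebraic_configuration C \<longleftrightarrow>
     finite C \<and> (\<forall>\<gamma>\<in>C. semialgebraic_curve \<gamma>) \<and>
     (\<forall>\<gamma>\<in>C. \<forall>\<delta>\<in>C. \<gamma> \<noteq> \<delta> \<longrightarrow> finite (\<gamma> \<inter> \<delta>)) \<and>
     (\<forall>p\<in>Sing C. ordinary_multiple_point_real C p)"

end

theory Submission
  imports Defs
begin

text \<open>
  The identity is a pointwise comparison of multiplicities. Deleting the curve \<open>\<gamma>\<close> lowers the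
  number of curves through a point by one if the point lies on \<open>\<gamma>\<close>, and leaves it alone
  otherwise. So, summed over the singular points of the \<^emph>\<open>old\<close> configuration, the terms
  \<open>k\<^sub>p - 1\<close> drop in total by the number of singular points on \<open>\<gamma>\<close>.

  The new configuration may have fewer singular points: the double points on \<open>\<gamma>\<close> disappear.
  At such a point exactly one curve remains, so its term in the sum over the old singular points
  is \<open>1 - 1 = 0\<close>; this is where it matters that \<open>\<psi>\<close> weights a point by \<open>k\<^sub>p - 1\<close>
  (\<open>psi_eq_sum_superset\<close>).

  Both the algebraic and the semialgebraic case are instances of the identity for finite
  families of sets with finite pairwise intersections (\<open>psi_remove_curve\<close>).
\<close>

lemma Sing_iff_curve_count:
  assumes "finite C"
  shows "p \<in> Sing C \<longleftrightarrow> 2 \<le> curve_count C p"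
  using assms unfolding curve_count_def
  by (auto simp: Sing_def card_le_Suc_iff numeral_2_eq_2 card_le_Suc0_iff_eq
      simp flip: not_less_eq_eq)

lemma Sing_mono: "C \<subseteq> D \<Longrightarrow> Sing C \<subseteq> Sing D"
  unfolding Sing_def by blast

lemma finite_Sing:
  assumes "finite C" and "\<And>\<gamma> \<delta>. \<gamma> \<in> C \<Longrightarrow> \<delta> \<in> C \<Longrightarrow> \<gamma> \<noteq> \<delta> \<Longrightarrow> finite (\<gamma> \<inter> \<delta>)"
  shows "finite (Sing C)"
proof -
  have "Sing C = (\<Union>\<gamma>\<in>C. \<Union>\<delta>\<in>C - {\<gamma>}. \<gamma> \<inter> \<delta>)"
    unfolding Sing_def by blast
  also have "finite \<dots>"
    using assms by (intro finite_UN_I) auto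
  finally show ?thesis .
qed

lemma curve_count_remove:
  assumes "finite C" and "\<gamma> \<in> C"
  shows "curve_count C p = curve_count (C - {\<gamma>}) p + of_bool (p \<in> \<gamma>)"
proof (cases "p \<in> \<gamma>")
  case True
  then have "{\<delta> \<in> C. p \<in> \<delta>} = insert \<gamma> {\<delta> \<in> C - {\<gamma>}. p \<in> \<delta>}"
    using assms by auto
  then show ?thesis
    using True assms by (simp add: curve_count_def)
next
  case False
  then have "{\<delta> \<in> C. p \<in> \<delta>} = {\<delta> \<in> C - {\<gamma>}. p \<in> \<delta>}"
    by auto
  then show ?thesis
    using False by (simp add: curve_count_def)
qed

text \<open>A point on exactly one curve has weight \<open>1 - 1 = 0\<close>, so the sum defining \<open>\<psi>\<close> may be
  extended over further points of the curves. Points on no curve have to be excluded, since their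
  weight would be \<open>-1\<close>.\<close>

lemma psi_eq_sum_superset:
  assumes "finite C" and "finite A" and "Sing C \<subseteq> A" and "A \<subseteq> \<Union>C"
  shows "psi C = (\<Sum>p\<in>A. int (curve_count C p) - 1)"
  unfolding psi_def
proof (rule sum.mono_neutral_left)
  show "\<forall>p\<in>A - Sing C. int (curve_count C p) - 1 = 0"
  proof
    fix p assume p: "p \<in> A - Sing C"
    then have "curve_count C p \<noteq> 0"
      using assms by (auto simp: curve_count_def)
    moreover have "curve_count C p < 2"
      using p assms(1) by (simp add: Sing_iff_curve_count)
    ultimately show "int (curve_count C p) - 1 = 0"
      by simp
  qed
qed (use assms in auto)

lemma psi_remove_curve:
  assumes fin: "finite C" and \<gamma>: "\<gamma> \<in> C"
    and fin_Int: "\<And>\<alpha> \<beta>. \<alpha> \<in> C \<Longrightarrow> \<beta> \<in> C \<Longrightarrow> \<alpha> \<noteq> \<beta> \<Longrightarrow> finite (\<alpha> \<inter> \<beta>)"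
  shows "psi C = psi (C - {\<gamma>}) + int (card (Sing C \<inter> \<gamma>))"
proof -
  have fin_Sing: "finite (Sing C)"
    using fin fin_Int by (rule finite_Sing)
  \<comment> \<open>A singular point lies on two curves, so at least one of them survives the removal.\<close>
  have cover: "Sing C \<subseteq> \<Union>(C - {\<gamma>})"
    by (auto simp: Sing_def)
  have "psi C = (\<Sum>p\<in>Sing C. (int (curve_count (C - {\<gamma>}) p) - 1) + of_bool (p \<in> \<gamma>))"
    unfolding psi_def by (simp add: curve_count_remove[OF fin \<gamma>] algebra_simps)
  also have "\<dots> = (\<Sum>p\<in>Sing C. int (curve_count (C - {\<gamma>}) p) - 1)
      + (\<Sum>p\<in>Sing C. of_bool (p \<in> \<gamma>))"
    by (rule sum.distrib)
  also have "(\<Sum>p\<in>Sing C. int (curve_count (C - {\<gamma>}) p) - 1) = psi (C - {\<gamma>})"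
    using fin fin_Sing cover by (intro psi_eq_sum_superset[symmetric] Sing_mono) auto
  also have "(\<Sum>p\<in>Sing C. of_bool (p \<in> \<gamma>)) = int (card (Sing C \<inter> \<gamma>))"
    using fin_Sing by simp
  finally show ?thesis .
qed

theorem corollary8p11:
  shows "(\<forall>(S :: ('k::alg_closed_field ^ 'n::finite) set set) C \<gamma>\<^sub>0.
            smooth_projective_surface S \<and> algebraic_configuration S C \<and> \<gamma>\<^sub>0 \<in> C \<longrightarrow>
              psi C = psi (C - {\<gamma>\<^sub>0}) + int (card (Sing C \<inter> \<gamma>\<^sub>0))) \<and>
         (\<forall>(C :: (real ^ 2) set set) \<gamma>\<^sub>0.
            semialgebraic_configuration C \<and> \<gamma>\<^sub>0 \<in> C \<longrightarrow>
              psi C = psi (C - {\<gamma>\<^sub>0}) + int (card (Sing C \<inter> \<gamma>\<^sub>0)))"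
  by (intro conjI allI impI psi_remove_curve)
    (auto simp: algebraic_configuration_def semialgebraic_configuration_def)

end
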